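(* For $w\in W_n$, the following are equivalent: (1) $w$ is vexillary; (2) the essential positions $(p_i,q_i)$ of $w$ can be ordered so that $p_1\ge\cdots\ge p_s>0$ and $q_1\ge\cdots\ge q_s>0$; (3) the permutation $\iota(w)$ is vexillary as an element of $S_{2n+1}$.
   Context: Write $\bar a$ for $-a$. A signed permutation is a bijection $w$ of $\mathbb Z$ with $w(\bar i)=\overline{w(i)}$ for all $i$ and $w(i)=i$ for $|i|$ large; $W_n$ is the group of those with $w(i)=i$ for $i>n$. $\iota(w)\in S_{2n+1}$ is the permutation of $\{\bar n,\dots,n\}$ with one-line notation $\overline{w(n)}\cdots\overline{w(1)}\,0\,w(1)\cdots w(n)$. An ordinary permutation $v$ is vexillary iff there are no $a<b<c<d$ with $v(b)<v(a)<v(d)<v(c)$. A triple is $\boldsymbol\tau=(\mathbf k,\mathbf p,\mathbf q)$ of $s$-tuples of positive integers ($s\ge 0$) with $0<k_1<\cdots<k_s$, $p_1\ge\cdots\ge p_s>0$, $q_1\ge\cdots\ge q_s>0$, and $p_i-p_{i+1}+q_i-q_{i+1}\ge k_{i+1}-k_i$ for $1\le i\le s-1$. The signed permutation $w(\boldsymbol\tau)$ is built on positions $1,2,\dots,n$: for $i=1,\dots,s$ in turn (with $k_0=0$), take the $k_i-k_{i-1}$ smallest positive integers $c\ge q_i$ not yet used, and place their negatives $\bar c$ in increasing order into the first $k_i-k_{i-1}$ vacant positions that are $\ge p_i$ (left to right), marking these $c$ as used; finally fill the remaining vacant positions, left to right, with the unused positive integers in increasing order (the empty triple gives the identity). $w$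 is vexillary if $w=w(\boldsymbol\tau)$ for some triple. Diagrams: for $v$ a permutation of $\{\bar n,\dots,n\}$, $D(v)=\{(a,b): v(b)>a \text{ and } v^{-1}(a)>b\}$ (box in row $a$, column $b$). The extended diagram of $w\in W_n$ is $\tilde D_w=\{(a,b)\in D(\iota(w)): b\le -1\}$; a SE corner of $\tilde D_w$ is a box $(a,b)\in\tilde D_w$ with $(a+1,b)\notin\tilde D_w$ and $(a,b+1)\notin\tilde D_w$. Rank function: $r_w(p,q)=\#\{i:\bar n\le i\le\bar p,\ w(i)\ge q\}$. The essential set $\mathscr{E}ss(w)$ is the set of $(k,p,q)$ with $(q-1,\bar p)$ a SE corner of $\tilde D_w$ and $k=r_w(p,q)$, except: if $p=1$ and $q<0$ then $(k,p,q)\notin\mathscr{E}ss(w)$; and if $p>1$, $q>0$, there is another SE corner in box $(\bar q,\bar p)$, and $k=r_w(p,q)=r_w(p,\bar q+1)-q+1$, then $(k,p,q)\notin\mathscr{E}ss(w)$. The essential positions are the pairs $(p,q)$ with $(k,p,q)\in\mathscr{E}ss(w)$ for some $k$. *)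

theory Defs
  imports "HOL-Library.Infinite_Set" "HOL-Combinatorics.Permutations"
begin

definition signed_permutation :: "(int \<Rightarrow> int) \<Rightarrow> bool" where
  "signed_permutation w \<longleftrightarrow>
     bij w \<and> (\<forall>i. w (- i) = - w i) \<and> (\<exists>N. \<forall>i. \<bar>i\<bar> > N \<longrightarrow> w i = i)"

definition W :: "nat \<Rightarrow> (int \<Rightarrow> int) set" where
  "W n = {w. signed_permutation w \<and> (\<forall>i > int n. w i = i)}"

text \<open>Permutations of \<open>{-n..n}\<close> are represented as functions on all integers that are the
  identity outside \<open>{-n..n}\<close>, as for \<open>permutes\<close>.\<close>

definition iota :: "nat \<Rightarrow> (int \<Rightarrow> int) \<Rightarrow> int \<Rightarrow> int" where
  "iota n w i =
     (if - int n \<le> i \<and> i < 0 then - w (- i)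
      else if 0 < i \<and> i \<le> int n then w i
      else i)"

definition perm_vexillary :: "int set \<Rightarrow> (int \<Rightarrow> int) \<Rightarrow> bool" where
  "perm_vexillary X v \<longleftrightarrow>
     \<not> (\<exists>a\<in>X. \<exists>b\<in>X. \<exists>c\<in>X. \<exists>d\<in>X.
          a < b \<and> b < c \<and> c < d \<and> v b < v a \<and> v a < v d \<and> v d < v c)"

text \<open>The entry \<open>k\<^sub>i\<close> of an \<open>s\<close>-tuple is \<open>ks ! (i - 1)\<close>.\<close>

definition is_triple :: "nat list \<Rightarrow> nat list \<Rightarrow> nat list \<Rightarrow> bool" where
  "is_triple ks ps qs \<longleftrightarrow>
     length ps = length ks \<and> length qs = length ks \<and>
     (\<forall>k\<in>set ks. 0 < k) \<and> sorted_wrt (<) ks \<and>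
     (\<forall>p\<in>set ps. 0 < p) \<and> sorted_wrt (\<ge>) ps \<and>
     (\<forall>q\<in>set qs. 0 < q) \<and> sorted_wrt (\<ge>) qs \<and>
     (\<forall>i. Suc i < length ks \<longrightarrow>
        int (ps ! i) - int (ps ! Suc i) + int (qs ! i) - int (qs ! Suc i)
          \<ge> int (ks ! Suc i) - int (ks ! i))"

text \<open>During the construction, \<open>f j = Some c\<close> records that the value \<open>-c\<close> has been placed in
  position \<open>j\<close>; thus \<open>dom f\<close> is the set of occupied positions and \<open>ran f\<close> the set of used values.
  Placing the negatives of the \<open>m\<close> chosen values in increasing order means placing the values
  themselves in decreasing order, hence \<open>rev\<close>.\<close>

definition place_step ::
  "nat \<Rightarrow> nat \<Rightarrow> nat \<Rightarrow> (nat \<rightharpoonup> nat) \<Rightarrow> (nat \<rightharpoonup> nat)" where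
  "place_step m p q f =
     f (map (enumerate {j. p \<le> j \<and> j \<notin> dom f}) [0..<m] [\<mapsto>]
        rev (map (enumerate {c. q \<le> c \<and> c \<notin> ran f}) [0..<m]))"

text \<open>The entry \<open>(0 # ks) ! i\<close> is \<open>k\<^sub>i\<close> with the convention \<open>k\<^sub>0 = 0\<close>.\<close>

primrec barred_entries ::
  "nat list \<Rightarrow> nat list \<Rightarrow> nat list \<Rightarrow> nat \<Rightarrow> (nat \<rightharpoonup> nat)" where
  "barred_entries ks ps qs 0 = Map.empty"
| "barred_entries ks ps qs (Suc i) =
     place_step (ks ! i - (0 # ks) ! i) (ps ! i) (qs ! i) (barred_entries ks ps qs i)"

text \<open>The construction is carried out on all positive positions at once. Since only finitely many
  barred entries are placed, the final filling is eventually the identity, so this agrees with the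
  construction on positions \<open>1, \<dots>, n\<close> for every sufficiently large \<open>n\<close>.\<close>

definition fill_positive :: "(nat \<rightharpoonup> nat) \<Rightarrow> nat \<Rightarrow> int" where
  "fill_positive f j =
     (case f j of
        Some c \<Rightarrow> - int c
      | None \<Rightarrow> int (enumerate {c. 0 < c \<and> c \<notin> ran f} (card {i. 0 < i \<and> i < j \<and> i \<notin> dom f})))"

definition triple_perm :: "nat list \<Rightarrow> nat list \<Rightarrow> nat list \<Rightarrow> int \<Rightarrow> int" where
  "triple_perm ks ps qs i =
     (let f = barred_entries ks ps qs (length ks) in
      if 0 < i then fill_positive f (nat i)
      else if i < 0 then - fill_positive f (nat (- i))
      else 0)"

definition signed_vexillary :: "(int \<Rightarrow> int) \<Rightarrow> bool" where
  "signed_vexillary w \<longleftrightarrow> (\<exists>ks ps qs. is_triple ks ps qs \<and> w = triple_perm ks ps qs)"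

text \<open>Boxes are pairs (row, column).\<close>

definition diagram :: "nat \<Rightarrow> (int \<Rightarrow> int) \<Rightarrow> (int \<times> int) set" where
  "diagram n v =
     {(a, b). a \<in> {- int n..int n} \<and> b \<in> {- int n..int n} \<and> v b > a \<and> inv v a > b}"

definition ext_diagram :: "nat \<Rightarrow> (int \<Rightarrow> int) \<Rightarrow> (int \<times> int) set" where
  "ext_diagram n w = {(a, b). (a, b) \<in> diagram n (iota n w) \<and> b \<le> -1}"

definition SE_corners :: "(int \<times> int) set \<Rightarrow> (int \<times> int) set" where
  "SE_corners D = {(a, b). (a, b) \<in> D \<and> (a + 1, b) \<notin> D \<and> (a, b + 1) \<notin> D}"

definition rank_fun :: "nat \<Rightarrow> (int \<Rightarrow> int) \<Rightarrow> int \<Rightarrow> int \<Rightarrow> int" where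
  "rank_fun n w p q = int (card {i. - int n \<le> i \<and> i \<le> - p \<and> w i \<ge> q})"

definition essential_set :: "nat \<Rightarrow> (int \<Rightarrow> int) \<Rightarrow> (int \<times> int \<times> int) set" where
  "essential_set n w =
     {(k, p, q).
        (q - 1, - p) \<in> SE_corners (ext_diagram n w) \<and>
        k = rank_fun n w p q \<and>
        \<not> (p = 1 \<and> q < 0) \<and>
        \<not> (p > 1 \<and> q > 0 \<and> (- q, - p) \<in> SE_corners (ext_diagram n w) \<and>
            k = rank_fun n w p (- q + 1) - q + 1)}"

definition essential_positions :: "nat \<Rightarrow> (int \<Rightarrow> int) \<Rightarrow> (int \<times> int) set" where
  "essential_positions n w = {(p, q). \<exists>k. (k, p, q) \<in> essential_set n w}"

end

theory Submission
  imports Defs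
begin

text \<open>
  All three conditions are equivalent to one statement about the corners of the Rothe diagram of
  \<open>w\<close>, viewed as a permutation of the integers: no corner lies strictly north-west of another.
  Every inversion of \<open>w\<close> encloses a corner, so this is the same as avoiding the pattern 2143.
  Since \<open>w\<close> is odd, the set of corners is invariant under \<open>(a, b) \<mapsto> (-a-1, -b-1)\<close>. A chain
  of corners therefore has no corner with \<open>a < 0\<close> and \<open>b < 0\<close>, and the corners excluded from the
  essential set come from such forbidden ones, which gives the equivalence with (2).

  For (1), an entry placed in step \<open>i\<close> of the construction leaves no gap to its left down to
  position \<open>p\<^sub>i\<close> and no gap below its value down to \<open>q\<^sub>i\<close>; this forces every corner to be one of
  the \<open>(p\<^sub>i, q\<^sub>i)\<close>. Conversely, if the corners form a chain, the triple made of the corners and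
  the numbers of entries in the quadrants they span rebuilds \<open>w\<close>: a gap next to an entry would be
  an inversion, hence enclose an earlier corner whose quadrant already contains the entry.
\<close>

section \<open>Corners\<close>

text \<open>For a bijection \<open>v\<close> these are the south-east corners of the Rothe diagram
  over all of the integers. Absence of the box below reduces to
  \<open>inv v (a + 1) \<le> b\<close>, since \<open>a < v b \<le> a + 1\<close> already forces
  \<open>inv v (a + 1) = b\<close>. The box to the right is treated in the same way.\<close>

definition corner :: "(int \<Rightarrow> int) \<Rightarrow> int \<Rightarrow> int \<Rightarrow> bool" where
  "corner v a b \<longleftrightarrow> a < v b \<and> v (b + 1) \<le> a \<and> b < inv v a \<and> inv v (a + 1) \<le> b"

definition corner_chain :: "(int \<Rightarrow> int) \<Rightarrow> bool" where
  "corner_chain v \<longleftrightarrow> (\<forall>a b a' b'. corner v a b \<longrightarrow> corner v a' b' \<longrightarrow> \<not> (a < a' \<and> b < b'))"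

text \<open>The inversion is itself the diagram box \<open>(v j, i)\<close>. Among the diagram boxes
  in the rectangle that it spans, one with the largest row plus column cannot be moved down or
  right.\<close>

lemma corner_in_inversion:
  assumes "bij v" and "i < j" and "v j < v i"
  obtains a b where "corner v a b" "v j \<le> a" "a < v i" "i \<le> b" "b < j"
proof -
  define X where "X = {(a, b). a \<in> {v j..<v i} \<and> b \<in> {i..<j} \<and> a < v b \<and> b < inv v a}"
  have invv: "inv v (v x) = x" for x
    using assms(1) by (simp add: bij_is_inj)
  have vinv: "v (inv v x) = x" for x
    using assms(1) by (simp add: bij_is_surj surj_f_inv_f)
  have "X \<subseteq> {v j..<v i} \<times> {i..<j}"
    by (auto simp: X_def)
  then have fin: "finite X"
    by (rule finite_subset) simp
  have "(v j, i) \<in> X"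
    using assms invv by (simp add: X_def)
  then have "Max ((\<lambda>x. fst x + snd x) ` X) \<in> (\<lambda>x. fst x + snd x) ` X"
    using fin by (intro Max_in) auto
  then obtain m where "m \<in> X" and mx: "Max ((\<lambda>x. fst x + snd x) ` X) = fst m + snd m"
    by auto
  then have m: "m \<in> X" "\<And>y. y \<in> X \<Longrightarrow> fst y + snd y \<le> fst m + snd m"
    using fin by (auto simp flip: mx)
  obtain a b where ab: "m = (a, b)" by fastforce
  have box: "v j \<le> a" "a < v i" "i \<le> b" "b < j" "a < v b" "b < inv v a"
    using m(1) unfolding ab X_def by auto
  have "(a + 1, b) \<notin> X" "(a, b + 1) \<notin> X"
    using m(2)[of "(a + 1, b)"] m(2)[of "(a, b + 1)"] ab by auto
  \<comment> \<open>\<open>(a + 1, b)\<close> may also miss \<open>X\<close> because its row leaves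
    the rectangle or because \<open>v b = a + 1\<close>; then row \<open>a + 1\<close> is the value
    at \<open>i\<close> or at \<open>b\<close>, and the corner condition still holds.\<close>
  moreover have "inv v (a + 1) \<le> b" if "a + 1 = v b \<or> a + 1 = v i"
    using that box invv by auto
  moreover have "v (b + 1) \<le> a" if "b + 1 = inv v a \<or> b + 1 = j"
    using that box vinv by auto
  ultimately have "inv v (a + 1) \<le> b" "v (b + 1) \<le> a"
    using box unfolding X_def by force+
  then show thesis
    using that box unfolding corner_def by blast
qed

text \<open>The two descents of a 2143 pattern enclose corners in rectangles that are separated in
  both directions. Conversely, corners \<open>(a, b)\<close> and \<open>(a', b')\<close> in
  north-west position give the pattern at the positions \<open>inv v (a + 1)\<close>,
  \<open>b + 1\<close>, \<open>b'\<close>, \<open>inv v a'\<close>.\<close>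

lemma corner_chain_iff_avoids_2143:
  assumes "bij v"
  shows "corner_chain v \<longleftrightarrow>
    \<not> (\<exists>a b c d. a < b \<and> b < c \<and> c < d \<and> v b < v a \<and> v a < v d \<and> v d < v c)"
proof
  assume chain: "corner_chain v"
  show "\<not> (\<exists>a b c d. a < b \<and> b < c \<and> c < d \<and> v b < v a \<and> v a < v d \<and> v d < v c)"
  proof
    assume "\<exists>a b c d. a < b \<and> b < c \<and> c < d \<and> v b < v a \<and> v a < v d \<and> v d < v c"
    then obtain i j k l where *: "i < j" "j < k" "k < l" "v j < v i" "v i < v l" "v l < v k"
      by blast
    obtain a b where "corner v a b" "v j \<le> a" "a < v i" "i \<le> b" "b < j"
      using corner_in_inversion[OF assms] * by blast
    moreover obtain a' b' where "corner v a' b'" "v l \<le> a'" "a' < v k" "k \<le> b'" "b' < l"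
      using corner_in_inversion[OF assms, of k l] * by blast
    ultimately show False
      using chain * unfolding corner_chain_def by force
  qed
next
  assume avoid: "\<not> (\<exists>a b c d. a < b \<and> b < c \<and> c < d \<and> v b < v a \<and> v a < v d \<and> v d < v c)"
  have vinv: "v (inv v x) = x" for x
    using assms by (simp add: bij_is_surj surj_f_inv_f)
  show "corner_chain v"
    unfolding corner_chain_def
  proof (intro allI impI notI)
    fix a b a' b'
    assume c: "corner v a b" "corner v a' b'" "a < a' \<and> b < b'"
    \<comment> \<open>Needed for strictness in the pattern. Adjacent rows would give
      \<open>inv v a' \<le> b < b' < inv v a'\<close>, and adjacent columns
      \<open>v b' \<le> a < a' < v b'\<close>.\<close>
    have "a' \<noteq> a + 1" "b' \<noteq> b + 1"
      using c unfolding corner_def by auto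
    then have "inv v (a + 1) < b + 1 \<and> b + 1 < b' \<and> b' < inv v a' \<and>
      v (b + 1) < v (inv v (a + 1)) \<and> v (inv v (a + 1)) < v (inv v a') \<and> v (inv v a') < v b'"
      using c unfolding corner_def vinv by auto
    then show False
      using avoid by blast
  qed
qed

locale odd_bijection =
  fixes w :: "int \<Rightarrow> int"
  assumes bij: "bij w" and odd: "w (- i) = - w i"
begin

lemma zero [simp]: "w 0 = 0"
  using odd[of 0] by simp

lemma inv_apply [simp]: "inv w (w x) = x"
  using bij by (simp add: bij_is_inj)

lemma apply_inv [simp]: "w (inv w x) = x"
  using bij by (simp add: bij_is_surj surj_f_inv_f)

lemma eq_iff [simp]: "w x = w y \<longleftrightarrow> x = y"
  using inv_apply by metis

lemma inv_odd: "inv w (- i) = - inv w i"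
  by (metis apply_inv inv_apply odd)

lemma inv_zero [simp]: "inv w 0 = 0"
  by (metis inv_apply zero)

text \<open>Under the half-turn, oddness exchanges the first two inequalities of
  \<open>corner\<close> with each other, and also the last two.\<close>

lemma corner_reflect: "corner w a b \<Longrightarrow> corner w (- a - 1) (- b - 1)"
  using odd[of b] odd[of "b + 1"] inv_odd[of a] inv_odd[of "a + 1"]
  by (auto simp: corner_def)

text \<open>These are the coordinates of the essential set, restricted to the quadrant with
  nonnegative row and negative column. In a chain every corner lies there or is the half-turn image
  of one that does.\<close>

definition pos_corner :: "int \<Rightarrow> int \<Rightarrow> bool" where
  "pos_corner p q \<longleftrightarrow> 0 < p \<and> 0 < q \<and> corner w (q - 1) (- p)"

text \<open>A corner with both coordinates negative lies strictly north-west of its half-turn image;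
  with both nonnegative, strictly south-east of it.\<close>

lemma chain_corner_quadrant:
  assumes "corner_chain w" and "corner w a b"
  shows "b < 0 \<longleftrightarrow> 0 \<le> a"
  using assms corner_reflect[OF assms(2)] unfolding corner_chain_def by force

lemma corner_chain_iff_pos_corner:
  "corner_chain w \<longleftrightarrow>
    (\<forall>a b. corner w a b \<longrightarrow> b < 0 \<longrightarrow> 0 \<le> a) \<and>
    (\<forall>p q p' q'. pos_corner p q \<longrightarrow> pos_corner p' q' \<longrightarrow> \<not> (p' < p \<and> q < q'))"
proof safe
  fix a b
  assume "corner_chain w" "corner w a b" "b < 0"
  then show "0 \<le> a"
    using chain_corner_quadrant by blast
next
  fix p q p' q'
  assume "corner_chain w" "pos_corner p q" "pos_corner p' q'" "p' < p" "q < q'"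
  then show False
    unfolding corner_chain_def pos_corner_def
    by (metis diff_strict_right_mono neg_less_iff_less)
next
  assume quad: "\<forall>a b. corner w a b \<longrightarrow> b < 0 \<longrightarrow> 0 \<le> a"
    and pos: "\<forall>p q p' q'. pos_corner p q \<longrightarrow> pos_corner p' q' \<longrightarrow> \<not> (p' < p \<and> q < q')"
  have quad': "a < 0" if "corner w a b" "0 \<le> b" for a b
    using quad corner_reflect[OF that(1)] that(2) by force
  \<comment> \<open>The first corner has \<open>b < 0\<close>, hence \<open>0 \<le> a\<close>. So
    the second has a positive row and, by \<open>quad'\<close>, a negative column: both are
    instances of \<open>pos_corner\<close>.\<close>
  have left: "\<not> (a < a' \<and> b < b')" if "corner w a b" "corner w a' b'" "b < 0" for a b a' b'
  proof
    assume less: "a < a' \<and> b < b'"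
    then have "0 \<le> a" "b' < 0"
      using that quad quad' by (blast, force)
    then have "pos_corner (- b) (a + 1)" "pos_corner (- b') (a' + 1)"
      using that less by (auto simp: pos_corner_def)
    then show False
      using pos less by force
  qed
  show "corner_chain w"
    unfolding corner_chain_def
  proof (intro allI impI notI)
    fix a b a' b'
    assume c: "corner w a b" "corner w a' b'" "a < a' \<and> b < b'"
    show False
    proof (cases "b < 0")
      case True
      then show False using left c by blast
    next
      case False
      \<comment> \<open>The half-turn reverses the north-west order, so the images enter
        \<open>left\<close> in swapped order, and now the column of the first one is
        negative.\<close>
      then show False
        using left[OF corner_reflect[OF c(2)] corner_reflect[OF c(1)]] c(3) by auto
    qed
  qed
qed

text \<open>A descent here reflects to an inversion with negative positions and values. It encloses
  a corner with both coordinates negative, which a chain does not have.\<close>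

lemma chain_positive_increasing:
  assumes "corner_chain w" and "0 < i" and "i < j" and "0 < w i" and "0 < w j"
  shows "w i < w j"
proof (rule ccontr)
  assume "\<not> w i < w j"
  then have "w (- i) < w (- j)"
    using assms odd by (simp add: order.not_eq_order_implies_strict)
  moreover have "- j < - i"
    using assms(3) by simp
  ultimately obtain a b where "corner w a b" "a < w (- j)" "b < - i"
    by (metis corner_in_inversion[OF bij])
  then show False
    using chain_corner_quadrant[OF assms(1)] assms odd by force
qed

text \<open>The corner comes from the reflected inversion at \<open>- j\<close> and
  \<open>- i\<close>. As \<open>0 \<le> i\<close>, its column is negative, and in a chain its row is
  then nonnegative. The result is a quadrant that contains the entry at \<open>j\<close> but starts
  to the right of \<open>i\<close>.\<close>

lemma pos_corner_left:
  assumes "corner_chain w" and "0 \<le> i" and "i < j" and "w j < 0" and "w j < w i"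
  obtains p q where "pos_corner p q" "i < p" "p \<le> j" "q \<le> - w j"
proof -
  have "- j < - i" "w (- i) < w (- j)"
    using assms odd by auto
  then obtain a b where "corner w a b" "a < w (- j)" "- j \<le> b" "b < - i"
    by (metis corner_in_inversion[OF bij])
  moreover have "0 \<le> a"
    using calculation chain_corner_quadrant[OF assms(1)] assms by force
  ultimately show thesis
    using that[of "- b" "a + 1"] assms odd by (auto simp: pos_corner_def)
qed

text \<open>Counterpart of \<open>pos_corner_left\<close> for values: here
  \<open>w i \<le> 0\<close> makes the row of the enclosed corner nonnegative, and the chain then
  makes its column negative.\<close>

lemma pos_corner_below:
  assumes "corner_chain w" and "i < j" and "w j < w i" and "w i \<le> 0"
  obtains p q where "pos_corner p q" "p \<le> j" "- w i < q" "q \<le> - w j"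
proof -
  have "- j < - i" "w (- i) < w (- j)"
    using assms odd by auto
  then obtain a b where "corner w a b" "w (- i) \<le> a" "a < w (- j)" "- j \<le> b" "b < - i"
    by (metis corner_in_inversion[OF bij])
  moreover have "b < 0"
    using calculation chain_corner_quadrant[OF assms(1)] assms odd by force
  ultimately show thesis
    using that[of "- b" "a + 1"] assms odd by (auto simp: pos_corner_def)
qed

text \<open>The pairs in \<open>L\<close> play the role of the \<open>(p\<^sub>i, q\<^sub>i)\<close> of a triple: an entry placed in step
  \<open>i\<close> has its gaps down to \<open>p\<^sub>i\<close> (positions) and down to \<open>q\<^sub>i\<close> (values) already closed.\<close>

lemma corner_chain_if_placed:
  assumes chain: "\<And>x y. x \<in> L \<Longrightarrow> y \<in> L \<Longrightarrow> fst x \<le> fst y \<and> snd x \<le> snd y \<or> fst y \<le> fst x \<and> snd y \<le> snd x"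
    and Lpos: "\<And>x. x \<in> L \<Longrightarrow> 0 < fst x \<and> 0 < snd x"
    and incr: "\<And>i j. 0 < i \<Longrightarrow> i < j \<Longrightarrow> 0 < w i \<Longrightarrow> 0 < w j \<Longrightarrow> w i < w j"
    and placed: "\<And>j. 0 < j \<Longrightarrow> w j < 0 \<Longrightarrow> \<exists>x\<in>L. fst x \<le> j \<and> snd x \<le> - w j \<and>
      (\<forall>i. fst x \<le> i \<and> i < j \<longrightarrow> w i < w j) \<and>
      (\<forall>c. snd x \<le> c \<and> c < - w j \<longrightarrow> (\<exists>i>j. w i = - c))"
  shows "corner_chain w"
proof -
  \<comment> \<open>Two barred entries witness the corner: the one at position \<open>p\<close>,
    with value at most \<open>- q\<close>, and the value \<open>- q\<close> at a position
    \<open>z \<ge> p\<close>. Since \<open>- q < w (p - 1)\<close>, the pair \<open>x\<close> of the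
    first entry has \<open>fst x = p\<close>. Since \<open>- (q - 1)\<close> occurs only left of
    \<open>p\<close>, the pair \<open>y\<close> of the second has \<open>snd y = q\<close>.
    Comparability in \<open>L\<close> makes one of them equal to \<open>(p, q)\<close>.\<close>
  have inL: "(p, q) \<in> L" if "pos_corner p q" for p q
  proof -
    have p: "0 < p" "0 < q" "w p \<le> - q" "- q < w (p - 1)"
      using that odd[of p] odd[of "p - 1"] by (auto simp: pos_corner_def corner_def)
    define z where "z = - inv w q"
    have z: "w z = - q" "p \<le> z"
      using that by (auto simp: pos_corner_def corner_def z_def odd)
    have q: "i < p" if "w i = - (q - 1)" for i
    proof -
      have "inv w (q - 1) = - i"
        by (metis that inv_apply minus_minus odd)
      then show ?thesis
        using \<open>pos_corner p q\<close> by (simp add: pos_corner_def corner_def)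
    qed
    obtain x where x: "x \<in> L" "fst x \<le> p" "snd x \<le> - w p"
      "\<And>i. fst x \<le> i \<Longrightarrow> i < p \<Longrightarrow> w i < w p"
      "\<And>c. snd x \<le> c \<Longrightarrow> c < - w p \<Longrightarrow> \<exists>i>p. w i = - c"
      using placed[of p] p by force
    obtain y where y: "y \<in> L" "fst y \<le> z" "snd y \<le> q"
      "\<And>i. fst y \<le> i \<Longrightarrow> i < z \<Longrightarrow> w i < - q"
      "\<And>c. snd y \<le> c \<Longrightarrow> c < q \<Longrightarrow> \<exists>i>z. w i = - c"
      using placed[of z] p z by force
    have xp: "fst x = p"
      using x(2) x(4)[of "p - 1"] p by force
    have yq: "snd y = q"
      using y(3) y(5)[of "q - 1"] q z(2) by force
    have "fst y = p" if "fst y \<le> p"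
      using that y(4)[of "p - 1"] p z by force
    moreover have "snd x = q" if "snd x \<le> q"
      using that x(5)[of "q - 1"] p q by force
    ultimately have "x = (p, q) \<or> y = (p, q)"
      using chain[OF x(1) y(1)] xp yq by (metis prod.collapse)
    then show ?thesis
      using x(1) y(1) by blast
  qed
  moreover have "0 \<le> a" if "corner w a b" "b < 0" for a b
  proof (rule ccontr)
    assume "\<not> 0 \<le> a"
    \<comment> \<open>Reflecting a corner with both coordinates negative gives a descent of positive
      values at the positions \<open>- b - 1\<close> and \<open>- inv w (a + 1)\<close>, against
      \<open>incr\<close>. The boundary cases \<open>b = -1\<close> and \<open>a = -1\<close> are
      excluded through \<open>w 0 = 0\<close>.\<close>
    have c: "w (- b - 1) \<ge> - a" "- inv w (a + 1) \<ge> - b" "w (- inv w (a + 1)) = - a - 1"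
      using that(1) odd[of "b + 1"] odd[of "inv w (a + 1)"] by (auto simp: corner_def)
    have "- b - 1 \<noteq> 0"
      using c \<open>\<not> 0 \<le> a\<close> by auto
    moreover have "- inv w (a + 1) \<noteq> 0"
      using c that by auto
    then have "- a - 1 \<noteq> 0"
      using c zero eq_iff by metis
    ultimately show False
      using incr[of "- b - 1" "- inv w (a + 1)"] c \<open>\<not> 0 \<le> a\<close> that by linarith
  qed
  moreover have "\<not> (p' < p \<and> q < q')" if "pos_corner p q" "pos_corner p' q'" for p q p' q'
    using chain[OF inL[OF that(1)] inL[OF that(2)]] by auto
  ultimately show ?thesis
    unfolding corner_chain_iff_pos_corner by blast
qed

end

section \<open>Essential positions\<close>

lemma W_odd_bijection: "w \<in> W n \<Longrightarrow> odd_bijection w"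
  by (simp add: W_def signed_permutation_def odd_bijection_def)

lemma W_fixed:
  assumes "w \<in> W n" and "int n < \<bar>i\<bar>"
  shows "w i = i"
proof (cases "0 < i")
  case True
  then show ?thesis
    using assms by (simp add: W_def)
next
  case False
  then have "w (- i) = - i"
    using assms by (simp add: W_def)
  then show ?thesis
    using assms odd_bijection.odd[OF W_odd_bijection, of w n i] by simp
qed

lemma W_abs_le:
  assumes "w \<in> W n" and "\<bar>i\<bar> \<le> int n"
  shows "\<bar>w i\<bar> \<le> int n"
proof (rule ccontr)
  assume "\<not> \<bar>w i\<bar> \<le> int n"
  then have "w (w i) = w i"
    using W_fixed[OF assms(1)] by simp
  then show False
    using odd_bijection.eq_iff[OF W_odd_bijection[OF assms(1)]] assms(2) \<open>\<not> \<bar>w i\<bar> \<le> int n\<close>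
    by metis
qed

lemma iota_eq:
  assumes "w \<in> W n"
  shows "iota n w = w"
proof
  fix i
  show "iota n w i = w i"
    using W_fixed[OF assms, of i] odd_bijection.odd[OF W_odd_bijection[OF assms], of i]
      odd_bijection.zero[OF W_odd_bijection[OF assms]]
    by (cases "i = 0") (auto simp: iota_def)
qed

text \<open>Every entry of a 2143 pattern belongs to an inversion, and all inversions of
  \<open>w\<close> lie in the window \<open>{- int n..int n}\<close>. Restricting the positions to
  the window thus loses no pattern.\<close>

lemma perm_vexillary_iff_corner_chain:
  assumes "w \<in> W n"
  shows "perm_vexillary {- int n..int n} (iota n w) \<longleftrightarrow> corner_chain w"
proof -
  interpret odd_bijection w
    using W_odd_bijection[OF assms] .
  have inv_in: "i \<in> {- int n..int n} \<and> j \<in> {- int n..int n}" if "i < j" "w j < w i" for i j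
  proof -
    have "\<bar>i\<bar> \<le> int n \<or> w i = i" "\<bar>j\<bar> \<le> int n \<or> w j = j"
      using W_fixed[OF assms] by force+
    then show ?thesis
      using W_abs_le[OF assms, of i] W_abs_le[OF assms, of j] that by force
  qed
  show ?thesis
    unfolding corner_chain_iff_avoids_2143[OF bij] perm_vexillary_def iota_eq[OF assms]
    using inv_in by blast
qed

text \<open>A diagram box records an inversion, at the positions \<open>b\<close> and
  \<open>inv w a\<close>, so its coordinates are bounded automatically.\<close>

lemma diagram_eq:
  assumes "w \<in> W n"
  shows "diagram n w = {(a, b). a < w b \<and> b < inv w a}"
proof -
  interpret odd_bijection w
    using W_odd_bijection[OF assms] .
  have "\<bar>a\<bar> \<le> int n \<and> \<bar>b\<bar> \<le> int n" if "a < w b" "b < inv w a" for a b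
  proof -
    have "\<bar>inv w a\<bar> \<le> int n \<or> inv w a = a" "\<bar>b\<bar> \<le> int n \<or> w b = b"
      using W_fixed[OF assms] apply_inv by (metis linorder_not_le)+
    then show ?thesis
      using W_abs_le[OF assms, of b] W_abs_le[OF assms, of "inv w a"] apply_inv[of a] that by force
  qed
  then show ?thesis
    unfolding diagram_def by (fastforce simp: abs_le_iff)
qed

text \<open>Cutting the diagram after column \<open>-1\<close> removes the right neighbours of that
  column and so can create corners there. For \<open>a \<ge> 0\<close> the missing condition
  \<open>w 0 \<le> a\<close> holds anyway, so all artificial corners have \<open>a < -1\<close>. In
  essential coordinates this is \<open>p = 1\<close>, \<open>q < 0\<close>, the first exception in
  \<open>essential_set\<close>.\<close>

lemma SE_corner_iff:
  assumes "w \<in> W n"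
  shows "(a, b) \<in> SE_corners (ext_diagram n w) \<longleftrightarrow>
    corner w a b \<and> b < 0 \<or> b = -1 \<and> a < -1 \<and> a < w b \<and> b < inv w a \<and> inv w (a + 1) \<le> b"
proof -
  interpret odd_bijection w
    using W_odd_bijection[OF assms] .
  have row: "inv w (a + 1) \<le> b \<longleftrightarrow> \<not> (a + 1 < w b \<and> b < inv w (a + 1))" if "a < w b"
    using that inv_apply[of b] by (cases "w b = a + 1") auto
  have col: "w (b + 1) \<le> a \<longleftrightarrow> \<not> (a < w (b + 1) \<and> b + 1 < inv w a)" if "b < inv w a"
    using that apply_inv[of a] by (cases "inv w a = b + 1") auto
  have "a \<noteq> -1" if "b = -1" "a < w b" "inv w (a + 1) \<le> b"
    using that by auto
  then show ?thesis
    using row col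
    unfolding SE_corners_def ext_diagram_def iota_eq[OF assms] diagram_eq[OF assms] corner_def
    by (cases "b = -1") auto
qed

text \<open>Sort by decreasing coordinate sum: when no two pairs are ordered oppositely in their
  coordinates, comparing the sums compares both coordinates.\<close>

lemma sorted_list_of_chain:
  fixes S :: "('a::linordered_ab_group_add \<times> 'a) set"
  assumes "finite S"
    and chain: "\<And>x y. x \<in> S \<Longrightarrow> y \<in> S \<Longrightarrow> \<not> (fst y < fst x \<and> snd x < snd y)"
  obtains xs where "distinct xs" "set xs = S"
    "sorted_wrt (\<lambda>x y. fst x \<ge> fst y \<and> snd x \<ge> snd y) xs"
proof -
  obtain ys where ys: "set ys = S" "distinct ys"
    using finite_distinct_list[OF assms(1)] by blast
  define key where "key x = - (fst x + snd x)" for x :: "'a \<times> 'a"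
  define xs where "xs = sort_key key ys"
  have xs: "distinct xs" "set xs = S"
    using ys by (auto simp: xs_def)
  have "sorted_wrt (\<lambda>x y. key x \<le> key y) xs"
    unfolding xs_def by (simp flip: sorted_wrt_map)
  moreover have "fst x \<ge> fst y \<and> snd x \<ge> snd y"
    if "x \<in> S" "y \<in> S" "key x \<le> key y" for x y
  proof -
    have le: "fst y + snd y \<le> fst x + snd x"
      using that(3) unfolding key_def neg_le_iff_le .
    have "fst y \<le> fst x"
    proof (rule ccontr)
      assume "\<not> fst y \<le> fst x"
      then have "snd y < snd x"
        using le by (meson add_less_le_mono linorder_not_le)
      then show False
        using chain[OF that(2,1)] \<open>\<not> fst y \<le> fst x\<close> by auto
    qed
    moreover have "snd y \<le> snd x"
    proof (rule ccontr)
      assume "\<not> snd y \<le> snd x"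
      then have "fst y < fst x"
        using le by (meson add_le_less_mono linorder_not_le)
      then show False
        using chain[OF that(1,2)] \<open>\<not> snd y \<le> snd x\<close> by auto
    qed
    ultimately show ?thesis by blast
  qed
  ultimately show thesis
    using that xs by (metis (no_types, lifting) sorted_wrt_mono_rel)
qed

lemma finite_pos_corners:
  assumes "w \<in> W n"
  shows "finite {(p, q). odd_bijection.pos_corner w p q}"
proof -
  interpret odd_bijection w
    using W_odd_bijection[OF assms] .
  have "(q - 1, - p) \<in> diagram n w" if "pos_corner p q" for p q
    using that by (simp add: pos_corner_def corner_def diagram_eq[OF assms])
  then have "{(p, q). pos_corner p q} \<subseteq> {- int n..int n} \<times> {- int n + 1..int n + 1}"
    by (force simp: diagram_def)
  then show ?thesis
    by (rule finite_subset) simp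
qed

text \<open>The first exception in \<open>essential_set\<close> removes the artificial corners. The
  second can remove \<open>(p, q)\<close> only if \<open>(- q, - p)\<close> is also a corner; the
  position \<open>(p, 1 - q)\<close> of that corner stays essential and violates positivity, and in
  a chain there is no such corner.\<close>

lemma essential_chain_iff_corner_chain:
  assumes "w \<in> W n"
  shows "(\<exists>xs. distinct xs \<and> set xs = essential_positions n w \<and>
              sorted_wrt (\<lambda>(p, q) (p', q'). p \<ge> p' \<and> q \<ge> q') xs \<and>
              (\<forall>(p, q)\<in>set xs. p > 0 \<and> q > 0)) \<longleftrightarrow> corner_chain w"
    (is "?L \<longleftrightarrow> _")
proof -
  interpret odd_bijection w
    using W_odd_bijection[OF assms] .
  note SE = SE_corner_iff[OF assms]
  have corner_if_ess: "corner w (q - 1) (- p) \<and> 0 < p" if "(p, q) \<in> essential_positions n w" for p q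
    using that by (auto simp: essential_positions_def essential_set_def SE)
  have ess_if_corner: "(p, q) \<in> essential_positions n w \<or> 0 < q \<and> (p, 1 - q) \<in> essential_positions n w"
    if "corner w (q - 1) (- p)" "0 < p" for p q
  proof -
    \<comment> \<open>A genuine corner in column \<open>-1\<close> satisfies
      \<open>w 0 \<le> q - 1\<close>, so the first exception does not apply to it.\<close>
    have "q \<ge> 0" if "p = 1"
      using that \<open>corner w (q - 1) (- p)\<close> by (auto simp: corner_def)
    moreover have "(q - 1, - p) \<in> SE_corners (ext_diagram n w)"
      using that by (simp add: SE)
    ultimately show ?thesis
      by (auto simp: essential_positions_def essential_set_def)
  qed
  show ?thesis
  proof
    assume ?L
    then obtain xs where xs: "set xs = essential_positions n w"
      "sorted_wrt (\<lambda>(p, q) (p', q'). p \<ge> p' \<and> q \<ge> q') xs" "\<forall>(p, q)\<in>set xs. p > 0 \<and> q > 0"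
      by blast
    have ess: "(p, q) \<in> essential_positions n w \<and> 0 < q" if "corner w (q - 1) (- p)" "0 < p" for p q
    proof -
      have "0 < q'" if "(p', q') \<in> essential_positions n w" for p' q'
        using that xs(1,3) by blast
      then show ?thesis
        using ess_if_corner[OF that] by fastforce
    qed
    have cmp: "\<not> (p' < p \<and> q < q')" if mem: "(p, q) \<in> set xs" "(p', q') \<in> set xs" for p q p' q'
    proof -
      obtain i j where "i < length xs" "j < length xs" "xs ! i = (p, q)" "xs ! j = (p', q')"
        using mem unfolding in_set_conv_nth by blast
      then show ?thesis
        using sorted_wrt_nth_less[OF xs(2), of i j] sorted_wrt_nth_less[OF xs(2), of j i]
        by (cases i j rule: linorder_cases) auto
    qed
    show "corner_chain w"
      unfolding corner_chain_iff_pos_corner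
    proof (intro conjI allI impI)
      fix a b
      assume "corner w a b" "b < 0"
      then show "0 \<le> a"
        using ess[of "a + 1" "- b"] by simp
    next
      fix p q p' q'
      assume "pos_corner p q" "pos_corner p' q'"
      then show "\<not> (p' < p \<and> q < q')"
        using cmp ess unfolding pos_corner_def xs(1) by blast
    qed
  next
    assume chain: "corner_chain w"
    have "essential_positions n w = {(p, q). pos_corner p q}"
    proof (rule set_eqI, clarsimp)
      fix p q
      have "0 < q" if "(p, q) \<in> essential_positions n w" for p q
        using corner_if_ess[OF that] chain_corner_quadrant[OF chain] by force
      then show "(p, q) \<in> essential_positions n w \<longleftrightarrow> pos_corner p q"
        using corner_if_ess[of p q] ess_if_corner[of q p] unfolding pos_corner_def by force
    qed
    moreover obtain xs where "distinct xs" "set xs = {(p, q). pos_corner p q}"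
      "sorted_wrt (\<lambda>x y. fst x \<ge> fst y \<and> snd x \<ge> snd y) xs"
      using sorted_list_of_chain[OF finite_pos_corners[OF assms]] chain
      unfolding corner_chain_iff_pos_corner by (auto simp: case_prod_beta)
    ultimately show ?L
      by (intro exI[of _ xs]) (auto simp: pos_corner_def elim!: sorted_wrt_mono_rel[rotated])
  qed
qed

section \<open>Placing barred entries\<close>

lemma card_below_enumerate:
  fixes A :: "nat set"
  assumes "infinite A"
  shows "card {y \<in> A. y < enumerate A t} = t"
proof -
  have "{y \<in> A. y < enumerate A t} = enumerate A ` {..<t}"
    using assms by (auto simp: enumerate_in_set elim: enumerate_Ex[OF assms, THEN exE])
  moreover have "inj_on (enumerate A) {..<t}"
    using strict_mono_enumerate[OF assms] strict_mono_imp_inj_on inj_on_subset by blast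
  ultimately show ?thesis
    by (simp add: card_image)
qed

lemma enumerate_card_below:
  fixes A :: "nat set"
  assumes "infinite A" and "x \<in> A"
  shows "enumerate A (card {y \<in> A. y < x}) = x"
  using enumerate_Ex[OF assms] card_below_enumerate[OF assms(1)] by metis

lemma infinite_ge_minus_finite:
  fixes D :: "nat set"
  assumes "finite D"
  shows "infinite {j. p \<le> j \<and> j \<notin> D}"
proof -
  have "{j. p \<le> j \<and> j \<notin> D} = {p..} - D"
    by auto
  then show ?thesis
    using assms by (simp add: infinite_Ici)
qed

text \<open>The index \<open>m - 1 - t\<close> comes from \<open>rev\<close>. Since
  \<open>[\<mapsto>]\<close> lets later pairs override earlier ones, the positions have to be
  distinct.\<close>

lemma place_step_enumerate:
  assumes A: "A = {j. p \<le> j \<and> j \<notin> dom f}" and B: "B = {c. q \<le> c \<and> c \<notin> ran f}"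
    and fin: "finite (dom f)" and t: "t < m"
  shows "place_step m p q f (enumerate A t) = Some (enumerate B (m - 1 - t))"
proof -
  let ?xs = "map (enumerate A) [0..<m]" and ?ys = "rev (map (enumerate B) [0..<m])"
  have "infinite A"
    using infinite_ge_minus_finite[OF fin] A by simp
  then have dist: "distinct ?xs"
    by (simp add: distinct_map strict_mono_enumerate strict_mono_imp_inj_on)
  have "(?xs ! t, ?ys ! t) \<in> set (rev (zip ?xs ?ys))"
    using t unfolding set_rev in_set_zip by (intro exI[of _ t]) simp
  moreover have "distinct (map fst (rev (zip ?xs ?ys)))"
    using dist by (simp flip: rev_map)
  ultimately have "map_of (rev (zip ?xs ?ys)) (?xs ! t) = Some (?ys ! t)"
    by (rule map_of_is_SomeI[rotated])
  then show ?thesis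
    using t by (simp add: place_step_def map_upds_def A B map_add_def rev_nth)
qed

lemma place_step_other:
  assumes "A = {j. p \<le> j \<and> j \<notin> dom f}" and "j \<notin> enumerate A ` {..<m}"
  shows "place_step m p q f j = f j"
  using assms by (simp add: place_step_def lessThan_atLeast0)

lemma finite_dom_place_step: "finite (dom f) \<Longrightarrow> finite (dom (place_step m p q f))"
  by (simp add: place_step_def)

lemma place_step_extends:
  assumes "finite (dom f)" and "f j = Some c"
  shows "place_step m p q f j = Some c"
proof -
  let ?A = "{j. p \<le> j \<and> j \<notin> dom f}"
  have "enumerate ?A t \<in> ?A" for t
    using enumerate_in_set infinite_ge_minus_finite[OF assms(1)] by blast
  then have "j \<notin> enumerate ?A ` {..<m}"
    using assms(2) by auto
  then show ?thesis
    using place_step_other[OF refl] assms(2) by simp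
qed

lemma place_step_eqI:
  assumes fin: "finite (dom f)" "finite (dom g)" and ext: "f \<subseteq>\<^sub>m g"
    and card: "card (dom g - dom f) = m"
    and inj: "\<And>i j c. g i = Some c \<Longrightarrow> g j = Some c \<Longrightarrow> i = j"
    and new: "\<And>j c. g j = Some c \<Longrightarrow> f j = None \<Longrightarrow> p \<le> j \<and> q \<le> c"
    and left: "\<And>i j c. g j = Some c \<Longrightarrow> f j = None \<Longrightarrow> p \<le> i \<Longrightarrow> i < j \<Longrightarrow> \<exists>d>c. g i = Some d"
    and below: "\<And>j c d. g j = Some c \<Longrightarrow> f j = None \<Longrightarrow> q \<le> d \<Longrightarrow> d < c \<Longrightarrow> \<exists>i>j. g i = Some d"
  shows "place_step m p q f = g"
proof -
  define A where "A = {j. p \<le> j \<and> j \<notin> dom f}"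
  define B where "B = {c. q \<le> c \<and> c \<notin> ran f}"
  define D where "D = dom g - dom f"
  have finD: "finite D"
    using fin by (simp add: D_def)
  have infA: "infinite A" and infB: "infinite B"
    using infinite_ge_minus_finite fin(1) finite_ran unfolding A_def B_def by blast+
  have DA: "D \<subseteq> A"
    using new by (auto simp: D_def A_def domIff)
  have fg: "g j = Some c" if "f j = Some c" for j c
    using ext that by (metis domI map_le_def)
  have placed: "card {y \<in> A. y < j} < m \<and> enumerate A (card {y \<in> A. y < j}) = j \<and>
      enumerate B (m - 1 - card {y \<in> A. y < j}) = c" if j: "j \<in> D" "g j = Some c" for j c
  proof -
    have fj: "f j = None"
      using j by (auto simp: D_def)
    have eA: "{y \<in> A. y < j} = {y \<in> D. y < j}"
      using DA left[OF j(2) fj] by (fastforce simp: A_def D_def)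
    \<comment> \<open>Apply \<open>left\<close> to the new position \<open>i\<close>: the earlier
      position \<open>j\<close> must carry a larger value.\<close>
    have rest: "\<exists>d<c. q \<le> d \<and> d \<notin> ran f \<and> g i = Some d" if i: "i \<in> D" "j < i" for i
    proof -
      obtain d where d: "g i = Some d" "f i = None"
        using i by (auto simp: D_def)
      moreover have "d \<notin> ran f"
        using inj fg d by (auto simp: ran_def) (metis option.distinct(1))
      ultimately show ?thesis
        using left[of i d j] new[of j c] new[of i d] i j fj by force
    qed
    have eB: "{y \<in> B. y < c} = (the \<circ> g) ` {i \<in> D. j < i}"
    proof (intro equalityI subsetI)
      fix y
      assume y: "y \<in> {y \<in> B. y < c}"
      then obtain i where i: "j < i" "g i = Some y"
        using below[OF j(2) fj] by (auto simp: B_def)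
      moreover have "i \<in> D"
      proof (rule ccontr)
        assume "i \<notin> D"
        then obtain d where "f i = Some d"
          using i by (auto simp: D_def)
        then show False
          using fg[of i d] i(2) y by (auto simp: B_def ran_def)
      qed
      ultimately show "y \<in> (the \<circ> g) ` {i \<in> D. j < i}"
        by force
    next
      fix y
      assume "y \<in> (the \<circ> g) ` {i \<in> D. j < i}"
      then show "y \<in> {y \<in> B. y < c}"
        using rest by (fastforce simp: B_def)
    qed
    have "inj_on (the \<circ> g) {i \<in> D. j < i}"
      using inj by (fastforce simp: inj_on_def D_def)
    then have cB: "card {y \<in> B. y < c} = card {i \<in> D. j < i}"
      unfolding eB by (rule card_image)
    have "D = {i \<in> D. i < j} \<union> ({j} \<union> {i \<in> D. j < i})"
      using j(1) by auto
    moreover have "card \<dots> = card {i \<in> D. i < j} + (1 + card {i \<in> D. j < i})"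
      using finD by (subst card_Un_disjoint; (subst card_Un_disjoint)?; auto)
    ultimately have "card D = card {i \<in> D. i < j} + (1 + card {i \<in> D. j < i})"
      by metis
    then have "m = card {i \<in> D. i < j} + (1 + card {i \<in> D. j < i})"
      using card by (simp flip: D_def)
    moreover have "c \<in> B"
    proof -
      have "c \<notin> ran f"
        using inj fg j(2) fj by (auto simp: ran_def) (metis option.distinct(1))
      then show ?thesis
        using new[OF j(2) fj] by (simp add: B_def)
    qed
    ultimately show ?thesis
      using enumerate_card_below[OF infA, of j] enumerate_card_below[OF infB, of c] DA j(1)
      unfolding eA cB by auto
  qed
  have sub: "D \<subseteq> enumerate A ` {..<m}"
  proof
    fix j
    assume j: "j \<in> D"
    then obtain c where "g j = Some c"
      by (auto simp: D_def)
    from placed[OF j this] show "j \<in> enumerate A ` {..<m}"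
      by (intro image_eqI[of _ _ "card {y \<in> A. y < j}"]) auto
  qed
  \<comment> \<open>\<open>D\<close> has exactly \<open>m\<close> elements, so the inclusion
    \<open>sub\<close> becomes an equality and \<open>g\<close> has no further new
    positions.\<close>
  have "card (enumerate A ` {..<m}) \<le> m"
    using card_image_le[of "{..<m}" "enumerate A"] by simp
  then have im: "enumerate A ` {..<m} = D"
    using card_seteq[OF _ sub] card D_def by simp
  show ?thesis
  proof
    fix j
    show "place_step m p q f j = g j"
    proof (cases "j \<in> D")
      case True
      then obtain c where c: "g j = Some c"
        by (auto simp: D_def)
      then show ?thesis
        using placed[OF True c] place_step_enumerate[OF A_def B_def fin(1), of "card {y \<in> A. y < j}" m]
        by simp
    next
      case False
      then have "place_step m p q f j = f j"
        using place_step_other[OF A_def] im by blast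
      then show ?thesis
        using False fg by (cases "f j"; cases "g j") (auto simp: D_def)
    qed
  qed
qed

section \<open>From triples to corners\<close>

text \<open>The inequality on \<open>m\<close> is the last condition in the definition of a triple; this is the only
  place where it matters.\<close>

lemma place_step_avoids_quadrant:
  assumes fin: "finite (dom f)" and old: "\<And>i c. f i = Some c \<Longrightarrow> p' \<le> i \<and> q' \<le> c"
    and m: "int m \<le> int p' - int p + int q' - int q" and pq: "p \<le> p'" "q \<le> q'"
    and t: "t < m" and j: "j = enumerate {j. p \<le> j \<and> j \<notin> dom f} t"
    and c: "c = enumerate {c. q \<le> c \<and> c \<notin> ran f} (m - 1 - t)"
  shows "j < p' \<or> c < q'"
proof (rule ccontr)
  assume "\<not> (j < p' \<or> c < q')"
  then have ge: "p' \<le> j" "q' \<le> c" by auto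
  define A where "A = {j. p \<le> j \<and> j \<notin> dom f}"
  define B where "B = {c. q \<le> c \<and> c \<notin> ran f}"
  have inf: "infinite A" "infinite B"
    using infinite_ge_minus_finite fin finite_ran unfolding A_def B_def by blast+
  \<comment> \<open>All old entries lie in the quadrant of \<open>(p', q')\<close>, so these strips
    are vacant. They give \<open>p' - p \<le> t\<close> and \<open>q' - q \<le> m - 1 - t\<close>,
    with sum below \<open>m\<close>.\<close>
  have "{p..<p'} \<subseteq> {y \<in> A. y < j}" "{q..<q'} \<subseteq> {y \<in> B. y < c}"
    using old ge by (fastforce simp: A_def B_def ran_def)+
  then have "card {p..<p'} \<le> card {y \<in> A. y < j}" "card {q..<q'} \<le> card {y \<in> B. y < c}"
    by (intro card_mono; simp)+
  moreover have "card {y \<in> A. y < j} = t" "card {y \<in> B. y < c} = m - 1 - t"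
    using card_below_enumerate inf j c by (simp_all flip: A_def B_def)
  ultimately show False
    using m pq t by simp
qed

text \<open>An invariant of the construction. That all entries lie in the latest quadrant is carried
  along for \<open>place_step_avoids_quadrant\<close>: a new entry misses the previous quadrant,
  which contains all older ones, and this puts older entries on the correct side of it. The index
  \<open>l\<close> is the step in which the entry was placed.\<close>

lemma barred_entries_placed:
  assumes triple: "is_triple ks ps qs" and "i \<le> length ks"
  shows "finite (dom (barred_entries ks ps qs i)) \<and>
    (\<forall>j c. barred_entries ks ps qs i j = Some c \<longrightarrow>
      0 < i \<and> ps ! (i - 1) \<le> j \<and> qs ! (i - 1) \<le> c \<and>
      (\<exists>l<i. ps ! l \<le> j \<and> qs ! l \<le> c \<and>
        (\<forall>j'. ps ! l \<le> j' \<and> j' < j \<longrightarrow> (\<exists>c'>c. barred_entries ks ps qs i j' = Some c')) \<and>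
        (\<forall>c'. qs ! l \<le> c' \<and> c' < c \<longrightarrow> (\<exists>j'>j. barred_entries ks ps qs i j' = Some c'))))"
  using assms(2)
proof (induction i)
  case 0
  then show ?case by simp
next
  case (Suc i)
  define f where "f = barred_entries ks ps qs i"
  define g where "g = barred_entries ks ps qs (Suc i)"
  define m where "m = ks ! i - (0 # ks) ! i"
  define p where "p = ps ! i"
  define q where "q = qs ! i"
  define A where "A = {j. p \<le> j \<and> j \<notin> dom f}"
  define B where "B = {c. q \<le> c \<and> c \<notin> ran f}"
  have g: "g = place_step m p q f"
    by (simp add: g_def f_def m_def p_def q_def)
  have fin: "finite (dom f)"
    using Suc by (simp add: f_def)
  have ext: "g j = Some c" if "f j = Some c" for j c
    using place_step_extends[OF fin that] g by simp
  have IH: "0 < i \<and> ps ! (i - 1) \<le> j \<and> qs ! (i - 1) \<le> c \<and>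
      (\<exists>l<i. ps ! l \<le> j \<and> qs ! l \<le> c \<and>
        (\<forall>j'. ps ! l \<le> j' \<and> j' < j \<longrightarrow> (\<exists>c'>c. f j' = Some c')) \<and>
        (\<forall>c'. qs ! l \<le> c' \<and> c' < c \<longrightarrow> (\<exists>j'>j. f j' = Some c')))"
    if "f j = Some c" for j c
    using Suc that by (simp add: f_def)
  have dec: "p \<le> ps ! (i - 1)" "q \<le> qs ! (i - 1)"
    "int m \<le> int (ps ! (i - 1)) - int p + int (qs ! (i - 1)) - int q" if "0 < i"
  proof -
    have i: "Suc (i - 1) = i" "i - 1 < i" "i < length ks"
      using that Suc.prems by auto
    then show "p \<le> ps ! (i - 1)" "q \<le> qs ! (i - 1)"
      using triple unfolding is_triple_def sorted_wrt_iff_nth_less p_def q_def by metis+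
    have "(0 # ks) ! i = ks ! (i - 1)"
      using that by (simp add: nth_Cons')
    \<comment> \<open>Strict increase keeps the natural subtraction in \<open>m\<close> from being
      cut off at zero.\<close>
    moreover have "ks ! (i - 1) < ks ! i"
      using triple i unfolding is_triple_def sorted_wrt_iff_nth_less by metis
    ultimately have "int m = int (ks ! i) - int (ks ! (i - 1))"
      by (simp add: m_def)
    also have "\<dots> \<le> int (ps ! (i - 1)) - int (ps ! i) + int (qs ! (i - 1)) - int (qs ! i)"
      using triple i unfolding is_triple_def by metis
    finally show "int m \<le> int (ps ! (i - 1)) - int p + int (qs ! (i - 1)) - int q"
      by (simp add: p_def q_def)
  qed
  have inf: "infinite A" "infinite B"
    using infinite_ge_minus_finite fin finite_ran unfolding A_def B_def by blast+
  have gA: "g (enumerate A t) = Some (enumerate B (m - 1 - t))" if "t < m" for t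
    unfolding g using place_step_enumerate[OF A_def B_def fin that] .
  have "0 < Suc i \<and> p \<le> j \<and> q \<le> c \<and>
      (\<exists>l<Suc i. ps ! l \<le> j \<and> qs ! l \<le> c \<and>
        (\<forall>j'. ps ! l \<le> j' \<and> j' < j \<longrightarrow> (\<exists>c'>c. g j' = Some c')) \<and>
        (\<forall>c'. qs ! l \<le> c' \<and> c' < c \<longrightarrow> (\<exists>j'>j. g j' = Some c')))"
    if gj: "g j = Some c" for j c
  proof (cases "f j")
    case (Some d)
    then have fj: "f j = Some c"
      using ext gj by fastforce
    then obtain l where "l < i" "ps ! l \<le> j" "qs ! l \<le> c"
      "\<forall>j'. ps ! l \<le> j' \<and> j' < j \<longrightarrow> (\<exists>c'>c. f j' = Some c')"
      "\<forall>c'. qs ! l \<le> c' \<and> c' < c \<longrightarrow> (\<exists>j'>j. f j' = Some c')"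
      using IH by blast
    then show ?thesis
      using IH[OF fj] dec ext by (meson le_trans less_SucI zero_less_Suc)
  next
    case None
    then have "j \<in> enumerate A ` {..<m}"
      using place_step_other[OF A_def, of j m q] gj g by fastforce
    then obtain t where t: "t < m" "j = enumerate A t"
      by blast
    then have c: "c = enumerate B (m - 1 - t)"
      using gA gj by simp
    have "j \<in> A" "c \<in> B"
      using t c inf enumerate_in_set by blast+
    then have ge: "p \<le> j" "q \<le> c"
      by (auto simp: A_def B_def)
    have new: "j < ps ! (i - 1) \<or> c < qs ! (i - 1)" if "0 < i"
      using place_step_avoids_quadrant[OF fin _ dec(3,1,2)[OF that] t(1)] IH t(2) c
      unfolding A_def B_def by blast
    have "\<exists>c'>c. g j' = Some c'" if j': "p \<le> j'" "j' < j" for j'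
    proof (cases "f j'")
      case None
      then have "j' \<in> A"
        using j' by (auto simp: A_def)
      then obtain u where u: "enumerate A u = j'"
        using enumerate_Ex inf by blast
      then have "u < t"
        using j' t inf by auto
      then have "c < enumerate B (m - 1 - u)"
        using c t inf by auto
      then show ?thesis
        using gA[of u] u \<open>u < t\<close> t by auto
    next
      case (Some d)
      \<comment> \<open>The older entry \<open>d\<close> at \<open>j'\<close> gives
        \<open>ps ! (i - 1) \<le> j' < j\<close>, so \<open>new\<close> leaves
        \<open>c < qs ! (i - 1) \<le> d\<close>.\<close>
      then show ?thesis
        using IH[OF Some] ext[OF Some] new j' by force
    qed
    moreover have "\<exists>j'>j. g j' = Some c'" if c': "q \<le> c'" "c' < c" for c'
    proof (cases "c' \<in> ran f")
      case False
      then have "c' \<in> B"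
        using c' by (auto simp: B_def)
      then obtain u where u: "enumerate B u = c'"
        using enumerate_Ex inf by blast
      then have "u < m - 1 - t"
        using c' c inf by auto
      then have "t < m - 1 - u" "m - 1 - u < m" "m - 1 - (m - 1 - u) = u"
        using t(1) by auto
      then show ?thesis
        using gA[of "m - 1 - u"] u t(2) inf by (metis enumerate_mono)
    next
      case True
      then obtain j' where j': "f j' = Some c'"
        by (auto simp: ran_def)
      \<comment> \<open>The same with roles exchanged: \<open>qs ! (i - 1) \<le> c' < c\<close>
        leaves \<open>j < ps ! (i - 1) \<le> j'\<close>.\<close>
      then have "j < j'"
        using IH[OF j'] new c' by linarith
      then show ?thesis
        using ext[OF j'] by blast
    qed
    ultimately show ?thesis
      using ge unfolding p_def q_def by blast
  qed
  moreover have "finite (dom g)"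
    unfolding g using finite_dom_place_step[OF fin] .
  ultimately show ?case
    unfolding g_def p_def q_def by simp
qed

lemma signed_vexillary_imp_corner_chain:
  assumes "w \<in> W n" and "signed_vexillary w"
  shows "corner_chain w"
proof -
  interpret odd_bijection w
    using W_odd_bijection[OF assms(1)] .
  obtain ks ps qs where triple: "is_triple ks ps qs" and w: "w = triple_perm ks ps qs"
    using assms(2) by (auto simp: signed_vexillary_def)
  define f where "f = barred_entries ks ps qs (length ks)"
  define A where "A = {i. 0 < i \<and> i \<notin> dom f}"
  define C where "C = {c. 0 < c \<and> c \<notin> ran f}"
  note placed = barred_entries_placed[OF triple order_refl, folded f_def]
  have fin: "finite (dom f)"
    using placed by blast
  have inf: "infinite C"
    using infinite_ge_minus_finite[OF finite_ran[OF fin], of 1] by (simp add: C_def Suc_le_eq)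
  have Some: "w (int j) = - int c \<and> 0 < c" if fj: "f j = Some c" "0 < j" for j c
  proof -
    obtain l where "l < length ks" "qs ! l \<le> c"
      using placed fj(1) by blast
    moreover have "0 < qs ! l"
      using triple calculation(1) unfolding is_triple_def by (metis nth_mem)
    ultimately show ?thesis
      using fj by (simp add: w triple_perm_def fill_positive_def f_def)
  qed
  have None: "w (int j) = int (enumerate C (card {i \<in> A. i < j})) \<and> 0 < w (int j)"
    if "f j = None" "0 < j" for j
  proof -
    have "{i. 0 < i \<and> i < j \<and> i \<notin> dom f} = {i \<in> A. i < j}"
      by (auto simp: A_def)
    then have "w (int j) = int (enumerate C (card {i \<in> A. i < j}))"
      using that by (simp add: w triple_perm_def fill_positive_def C_def flip: f_def)
    moreover have "0 < enumerate C (card {i \<in> A. i < j})"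
      using enumerate_in_set[OF inf] by (simp add: C_def)
    ultimately show ?thesis
      by simp
  qed
  have neg: "\<exists>c. f (nat j) = Some c \<and> w j = - int c" if "0 < j" "w j < 0" for j
    using that Some[of "nat j"] None[of "nat j"] by (cases "f (nat j)") auto
  define L where "L = (\<lambda>l. (int (ps ! l), int (qs ! l))) ` {..<length ks}"
  show ?thesis
  proof (rule corner_chain_if_placed[of L])
    fix x y
    assume "x \<in> L" "y \<in> L"
    then obtain l k where lk: "l < length ks" "k < length ks"
      "x = (int (ps ! l), int (qs ! l))" "y = (int (ps ! k), int (qs ! k))"
      by (auto simp: L_def)
    have "ps ! i \<ge> ps ! j \<and> qs ! i \<ge> qs ! j" if "i < j" "j < length ks" for i j
      using triple that unfolding is_triple_def sorted_wrt_iff_nth_less by metis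
    then show "fst x \<le> fst y \<and> snd x \<le> snd y \<or> fst y \<le> fst x \<and> snd y \<le> snd x"
      using lk by (cases l k rule: linorder_cases) auto
  next
    fix x
    assume "x \<in> L"
    then show "0 < fst x \<and> 0 < snd x"
      using triple unfolding L_def is_triple_def by auto
  next
    fix i j
    assume ij: "0 < i" "i < j" "0 < w i" "0 < w j"
    have "f (nat k) = None" if "0 < k" "0 < w k" for k
      using that Some[of "nat k"] by (cases "f (nat k)") auto
    then have None': "f (nat i) = None" "f (nat j) = None"
      using ij by auto
    have "nat i \<in> {k \<in> A. k < nat j}"
      using None' ij by (auto simp: A_def)
    moreover have "{k \<in> A. k < nat i} \<subseteq> {k \<in> A. k < nat j}"
      using ij by auto
    ultimately have "{k \<in> A. k < nat i} \<subset> {k \<in> A. k < nat j}"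
      by blast
    then have "card {k \<in> A. k < nat i} < card {k \<in> A. k < nat j}"
      by (intro psubset_card_mono) auto
    then show "w i < w j"
      using None[OF None'(1)] None[OF None'(2)] ij inf by simp
  next
    fix j
    assume j: "0 < j" "w j < 0"
    then obtain c where c: "f (nat j) = Some c" "w j = - int c"
      using neg by blast
    obtain l where l: "l < length ks" "ps ! l \<le> nat j" "qs ! l \<le> c"
        "\<forall>j'. ps ! l \<le> j' \<and> j' < nat j \<longrightarrow> (\<exists>c'>c. f j' = Some c')"
        "\<forall>c'. qs ! l \<le> c' \<and> c' < c \<longrightarrow> (\<exists>j'>nat j. f j' = Some c')"
      using placed[THEN conjunct2, rule_format, OF c(1)] by blast
    have "0 < ps ! l"
      using triple l(1) unfolding is_triple_def by (metis nth_mem)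
    have "w i < w j" if "int (ps ! l) \<le> i" "i < j" for i
    proof -
      have "ps ! l \<le> nat i" "nat i < nat j" "0 < nat i"
        using that \<open>0 < ps ! l\<close> by auto
      then obtain d where "c < d" "f (nat i) = Some d"
        using l(4) by blast
      then show ?thesis
        using Some[of "nat i" d] c(2) \<open>0 < nat i\<close> by simp
    qed
    moreover have "\<exists>i>j. w i = - d" if "int (qs ! l) \<le> d" "d < - w j" for d
    proof -
      have "qs ! l \<le> nat d" "nat d < c"
        using that c by auto
      then obtain i where "nat j < i" "f i = Some (nat d)"
        using l(5) by blast
      then show ?thesis
        using Some[of i "nat d"] that by (intro exI[of _ "int i"]) auto
    qed
    ultimately show "\<exists>x\<in>L. fst x \<le> j \<and> snd x \<le> - w j \<and>
      (\<forall>i. fst x \<le> i \<and> i < j \<longrightarrow> w i < w j) \<and>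
      (\<forall>c. snd x \<le> c \<and> c < - w j \<longrightarrow> (\<exists>i>j. w i = - c))"
      using l(1-3) c(2) j by (intro bexI[of _ "(int (ps ! l), int (qs ! l))"]) (auto simp: L_def)
  qed
qed

section \<open>From corners to triples\<close>

lemma corner_chain_imp_signed_vexillary:
  assumes W: "w \<in> W n" and chain: "corner_chain w"
  shows "signed_vexillary w"
proof -
  interpret odd_bijection w
    using W_odd_bijection[OF W] .
  obtain xs where xs: "distinct xs" "set xs = {(p, q). pos_corner p q}"
    and sorted: "sorted_wrt (\<lambda>x y. fst x \<ge> fst y \<and> snd x \<ge> snd y) xs"
    using sorted_list_of_chain[OF finite_pos_corners[OF W]] chain
    unfolding corner_chain_iff_pos_corner by (auto simp: case_prod_beta)

  \<comment> \<open>Candidate triple and the entries in its quadrants\<close>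
  define s where "s = length xs"
  define P where "P i = nat (fst (xs ! i))" for i
  define Q where "Q i = nat (snd (xs ! i))" for i
  define F where "F j = (if 0 < j \<and> w (int j) < 0 then Some (nat (- w (int j))) else None)" for j
  \<comment> \<open>Positions of the barred entries in the quadrant of the \<open>i\<close>-th
    corner. Up to the sign change of positions and values, \<open>card (E i)\<close> is the rank
    \<open>rank_fun n w (P i) (Q i)\<close> at that corner.\<close>
  define E where "E i = {j. \<exists>c. F j = Some c \<and> P i \<le> j \<and> Q i \<le> c}" for i
  define ks where "ks = map (\<lambda>i. card (E i)) [0..<s]"
  define ps where "ps = map P [0..<s]"
  define qs where "qs = map Q [0..<s]"

  have F_iff: "F j = Some c \<longleftrightarrow> 0 < j \<and> 0 < c \<and> w (int j) = - int c" for j c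
    by (auto simp: F_def)
  have F_inj: "i = j" if "F i = Some c" "F j = Some c" for i j c
    using that eq_iff[of "int i" "int j"] by (simp add: F_iff)
  have "dom F \<subseteq> {..n}"
  proof
    fix j
    assume "j \<in> dom F"
    then show "j \<in> {..n}"
      using W_fixed[OF W, of "int j"] by (cases "j \<le> n") (auto simp: F_iff)
  qed
  then have finF: "finite (dom F)"
    using finite_subset by blast
  have E_dom: "E i \<subseteq> dom F" for i
    by (auto simp: E_def)
  have finE: "finite (E i)" for i
    using finite_subset[OF E_dom finF] .

  have corner_nth: "pos_corner (int (P i)) (int (Q i)) \<and> 0 < P i \<and> 0 < Q i" if "i < s" for i
  proof -
    have "pos_corner (fst (xs ! i)) (snd (xs ! i))"
      using that xs(2) nth_mem[of i xs] by (auto simp: s_def)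
    then show ?thesis
      by (simp add: P_def Q_def pos_corner_def)
  qed
  have nth_corner: "\<exists>i<s. p = int (P i) \<and> q = int (Q i)" if "pos_corner p q" for p q
  proof -
    have "(p, q) \<in> set xs"
      using that xs(2) by simp
    then obtain i where "i < s" "xs ! i = (p, q)"
      unfolding in_set_conv_nth s_def by blast
    then show ?thesis
      using that by (intro exI[of _ i]) (simp add: P_def Q_def pos_corner_def)
  qed
  have dec: "P j \<le> P i \<and> Q j \<le> Q i" if "i \<le> j" "j < s" for i j
    using sorted_wrt_nth_less[OF sorted, of i j] that
    by (cases "i = j") (auto simp: P_def Q_def s_def nat_mono)
  have E_mono: "E i \<subseteq> E j" if "i \<le> j" "j < s" for i j
    using dec[OF that] by (auto simp: E_def)

  have corner_entries: "\<exists>c. F (P i) = Some c \<and> Q i \<le> c" "\<exists>j\<ge>P i. F j = Some (Q i)"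
    if "i < s" for i
  proof -
    have c: "pos_corner (int (P i)) (int (Q i))" "0 < P i" "0 < Q i"
      using corner_nth[OF that] by auto
    then have "w (int (P i)) \<le> - int (Q i)"
      using odd[of "int (P i)"] by (simp add: pos_corner_def corner_def)
    then show "\<exists>c. F (P i) = Some c \<and> Q i \<le> c"
      using c by (intro exI[of _ "nat (- w (int (P i)))"]) (auto simp: F_iff)
    have le: "int (P i) \<le> - inv w (int (Q i))"
      using c by (simp add: pos_corner_def corner_def)
    moreover have "w (- inv w (int (Q i))) = - int (Q i)"
      by (simp add: odd)
    ultimately show "\<exists>j\<ge>P i. F j = Some (Q i)"
      using c by (intro exI[of _ "nat (- inv w (int (Q i)))"]) (auto simp: F_iff)
  qed

  \<comment> \<open>The corners and their ranks form a triple\<close>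
  have triple: "is_triple ks ps qs"
  proof -
    have strict: "card (E i) < card (E j)" if ij: "i < j" "j < s" for i j
    proof -
      have neq: "P i \<noteq> P j \<or> Q i \<noteq> Q j"
      proof (rule ccontr)
        assume eq: "\<not> (P i \<noteq> P j \<or> Q i \<noteq> Q j)"
        have pos: "0 < fst (xs ! k) \<and> 0 < snd (xs ! k)" if "k < s" for k
          using that xs(2) nth_mem[of k xs] by (auto simp: s_def pos_corner_def)
        have "xs ! i = xs ! j"
          using eq pos[of i] pos[of j] ij by (auto simp: P_def Q_def prod_eq_iff eq_nat_nat_iff)
        then show False
          using xs(1) ij by (simp add: nth_eq_iff_index_eq s_def)
      qed
      obtain c where c: "F (P j) = Some c" "Q j \<le> c"
        using corner_entries(1)[OF ij(2)] by blast
      obtain z where z: "P j \<le> z" "F z = Some (Q j)"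
        using corner_entries(2)[OF ij(2)] by blast
      \<comment> \<open>If \<open>P j < P i\<close>, then position \<open>P j\<close> is new;
        otherwise \<open>Q j < Q i\<close>, and the position \<open>z\<close> of the value
        \<open>- Q j\<close> is new.\<close>
      have "P j \<in> E j - E i \<or> z \<in> E j - E i"
        using neq c z dec[of i j] ij by (auto simp: E_def)
      then have "E i \<subset> E j"
        using E_mono[of i j] ij by auto
      then show ?thesis
        by (rule psubset_card_mono[OF finE])
    qed
    have pos: "0 < card (E i)" if "i < s" for i
      using corner_entries(1)[OF that] finE[of i] by (auto simp: card_gt_0_iff E_def)
    \<comment> \<open>An entry gained from quadrant \<open>i\<close> to the next lies in a strip of
      positions or in a strip of values. As \<open>F\<close> is injective, each strip holds at most
      as many entries as it is wide.\<close>
    have step: "int (P i) - int (P (Suc i)) + int (Q i) - int (Q (Suc i))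
          \<ge> int (card (E (Suc i))) - int (card (E i))" if "Suc i < s" for i
    proof -
      let ?V = "{j. \<exists>c\<in>{Q (Suc i)..<Q i}. F j = Some c}"
      have V: "inj_on (\<lambda>j. the (F j)) ?V" "(\<lambda>j. the (F j)) ` ?V \<subseteq> {Q (Suc i)..<Q i}"
        using F_inj by (auto simp: inj_on_def)
      have "card ?V \<le> card {Q (Suc i)..<Q i}"
        using V by (intro card_inj_on_le[where f = "\<lambda>j. the (F j)"]) auto
      moreover have "E (Suc i) - E i \<subseteq> {P (Suc i)..<P i} \<union> ?V"
        by (auto simp: E_def)
      then have "card (E (Suc i) - E i) \<le> card ({P (Suc i)..<P i} \<union> ?V)"
        using V inj_on_finite by (intro card_mono) blast+
      moreover have "card ({P (Suc i)..<P i} \<union> ?V) \<le> card {P (Suc i)..<P i} + card ?V"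
        by (rule card_Un_le)
      moreover have "card (E (Suc i)) = card (E i) + card (E (Suc i) - E i)"
        using E_mono[of i "Suc i"] that finE
        by (metis card_Diff_subset card_mono le_add_diff_inverse lessI less_imp_le)
      moreover have "P (Suc i) \<le> P i" "Q (Suc i) \<le> Q i"
        using dec[of i "Suc i"] that by auto
      ultimately show ?thesis
        by simp
    qed
    show ?thesis
      using strict pos step corner_nth dec
      by (auto simp: is_triple_def ks_def ps_def qs_def sorted_wrt_iff_nth_less)
  qed

  \<comment> \<open>Reconstruction of the barred entries\<close>
  have barred: "barred_entries ks ps qs i = F |` (\<Union>l<i. E l)" if "i \<le> s" for i
    using that
  proof (induction i)
    case 0
    then show ?case by simp
  next
    case (Suc i)
    define U where "U = (\<Union>l<i. E l)"
    \<comment> \<open>The quadrants grow, so \<open>U\<close> is the previous quadrant. For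
      \<open>i = 0\<close> it is empty, in accordance with the leading \<open>0\<close> in
      \<open>0 # ks\<close>.\<close>
    have U: "E i = (\<Union>l<Suc i. E l)" "U \<subseteq> E i" "card U = (0 # ks) ! i"
    proof -
      show "E i = (\<Union>l<Suc i. E l)"
        using E_mono Suc.prems by (fastforce simp: less_Suc_eq_le)
      then show "U \<subseteq> E i"
        by (auto simp: U_def)
      show "card U = (0 # ks) ! i"
      proof (cases i)
        case 0
        then show ?thesis by (simp add: U_def)
      next
        case (Suc k)
        then have "U = E k"
          using E_mono \<open>Suc i \<le> s\<close> by (fastforce simp: U_def less_Suc_eq_le)
        then show ?thesis
          using Suc \<open>Suc i \<le> s\<close> by (simp add: ks_def)
      qed
    qed
    \<comment> \<open>A corner exceeding the \<open>i\<close>-th in some coordinate comes earlier in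
      the list, so its whole quadrant already belongs to \<open>U\<close>. The gap conditions
      follow: a gap would be an inversion enclosing such a corner, with the new entry in its
      quadrant.\<close>
    have notU: False if "F j = Some c" "j \<notin> U" "pos_corner p q" "p \<le> int j" "q \<le> int c"
      "int (P i) < p \<or> int (Q i) < q" for j c p q
    proof -
      obtain l where l: "l < s" "p = int (P l)" "q = int (Q l)"
        using nth_corner[OF \<open>pos_corner p q\<close>] by blast
      have "l < i"
        using dec[of i l] l that(6) by force
      then show False
        using that l by (auto simp: U_def E_def)
    qed
    have "place_step (ks ! i - (0 # ks) ! i) (P i) (Q i) (F |` U) = F |` E i"
    proof (rule place_step_eqI)
      show "finite (dom (F |` U))" "finite (dom (F |` E i))"
        using finF by auto
      show "F |` U \<subseteq>\<^sub>m F |` E i"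
        using U(2) by (auto simp: map_le_def restrict_map_def)
      have "dom (F |` E i) - dom (F |` U) = E i - U"
        using E_dom[of i] by auto
      then show "card (dom (F |` E i) - dom (F |` U)) = ks ! i - (0 # ks) ! i"
        using card_Diff_subset[OF finite_subset[OF U(2) finE] U(2)] U(3) Suc.prems
        by (simp add: ks_def)
      show "j = k" if "(F |` E i) j = Some c" "(F |` E i) k = Some c" for j k c
        using that F_inj by (auto simp: restrict_map_def split: if_splits)
      fix j c
      assume "(F |` E i) j = Some c" "(F |` U) j = None"
      then have j: "F j = Some c" "j \<in> E i" "j \<notin> U"
        by (auto simp: restrict_map_def split: if_splits)
      then show ge: "P i \<le> j \<and> Q i \<le> c"
        by (auto simp: E_def)
      have wj: "w (int j) = - int c" "0 < j" "0 < c"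
        using j(1) by (auto simp: F_iff)
      have Pi: "0 < P i" "0 < Q i"
        using corner_nth[of i] Suc.prems by auto
      show "\<exists>d>c. (F |` E i) k = Some d" if k: "P i \<le> k" "k < j" for k
      proof -
        have "w (int k) < w (int j)"
        proof (rule ccontr)
          assume "\<not> w (int k) < w (int j)"
          moreover have "w (int k) \<noteq> w (int j)"
            using k by simp
          ultimately have less: "w (int j) < w (int k)"
            by linarith
          have kj: "0 \<le> int k" "int k < int j" "w (int j) < 0"
            using k wj by auto
          obtain p q where "pos_corner p q" "int k < p" "p \<le> int j" "q \<le> - w (int j)"
            using pos_corner_left[OF chain kj less] by blast
          then show False
            using notU[OF j(1,3)] wj k by force
        qed
        then have "F k = Some (nat (- w (int k)))" "c < nat (- w (int k))"
          using wj Pi k by (auto simp: F_iff)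
        moreover from this have "k \<in> E i"
          using k ge by (auto simp: E_def)
        ultimately show ?thesis
          by simp
      qed
      show "\<exists>k>j. (F |` E i) k = Some d" if d: "Q i \<le> d" "d < c" for d
      proof -
        define x where "x = - inv w (int d)"
        have x: "w x = - int d"
          by (simp add: x_def odd)
        have "int j < x"
        proof (rule ccontr)
          assume "\<not> int j < x"
          moreover have "x \<noteq> int j"
            using x wj d by auto
          ultimately have less: "x < int j" "w (int j) < w x" "w x \<le> 0"
            using x wj d by auto
          obtain p q where "pos_corner p q" "p \<le> int j" "- w x < q" "q \<le> - w (int j)"
            using pos_corner_below[OF chain less] by blast
          then show False
            using notU[OF j(1,3)] wj d x by force
        qed
        then have "F (nat x) = Some d" "j < nat x"
          using x d Pi by (auto simp: F_iff)
        moreover from this have "nat x \<in> E i"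
          using d ge by (auto simp: E_def)
        ultimately show ?thesis
          by (intro exI[of _ "nat x"]) simp
      qed
    qed
    then show ?case
      using Suc U(1) by (simp add: U_def ps_def qs_def)
  qed

  have "F |` (\<Union>l<s. E l) = F"
  proof
    fix j
    show "(F |` (\<Union>l<s. E l)) j = F j"
    proof (cases "F j")
      case None
      then show ?thesis by (simp add: restrict_map_def)
    next
      case (Some c)
      then have j: "0 < int j" "w (int j) < 0" "w (int j) < w 0" "w (int j) = - int c"
        by (auto simp: F_iff)
      \<comment> \<open>As \<open>w 0 = 0\<close>, the positions \<open>0\<close> and
        \<open>j\<close> form an inversion, so every barred entry lies in the quadrant of some
        corner.\<close>
      obtain p q where "pos_corner p q" "p \<le> int j" "q \<le> - w (int j)"
        using pos_corner_left[OF chain order_refl j(1-3)] by blast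
      then obtain l where "l < s" "P l \<le> j" "Q l \<le> c"
        using nth_corner[of p q] j(4) by auto
      then have "j \<in> (\<Union>l<s. E l)"
        using Some by (auto simp: E_def)
      then show ?thesis by simp
    qed
  qed
  then have F: "barred_entries ks ps qs (length ks) = F"
    using barred[of s] by (simp add: ks_def)

  \<comment> \<open>Reconstruction of the positive entries\<close>
  have fill: "fill_positive F j = w (int j)" if j: "0 < j" for j
  proof (cases "F j")
    case (Some c)
    moreover have "w (int j) = - int c"
      using Some F_iff by blast
    ultimately show ?thesis by (simp add: fill_positive_def)
  next
    case None
    define C where "C = {c. 0 < c \<and> c \<notin> ran F}"
    define A where "A = {i. 0 < i \<and> i < j \<and> i \<notin> dom F}"
    have infC: "infinite C"
      using infinite_ge_minus_finite[OF finite_ran[OF finF], of 1] by (simp add: C_def Suc_le_eq)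
    have pos: "0 < w (int i) \<and> nat (w (int i)) \<in> C" if i: "0 < i" "i \<notin> dom F" for i
    proof -
      have "w (int i) \<noteq> w 0"
        using i by (simp del: zero)
      then have "0 < w (int i)"
        using i by (auto simp: F_def split: if_splits)
      moreover have "nat (w (int i)) \<notin> ran F"
      proof
        assume "nat (w (int i)) \<in> ran F"
        then obtain k where "0 < k" "w (int k) = - w (int i)"
          using \<open>0 < w (int i)\<close> by (auto simp: ran_def F_iff)
        then show False
          using eq_iff[of "int k" "- int i"] odd i by simp
      qed
      ultimately show ?thesis
        by (simp add: C_def)
    qed
    have j': "0 < w (int j)" "nat (w (int j)) \<in> C"
      using pos[of j] None j by auto
    have "{y \<in> C. y < nat (w (int j))} = (\<lambda>i. nat (w (int i))) ` A"
    proof (intro equalityI subsetI)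
      fix y
      assume y: "y \<in> {y \<in> C. y < nat (w (int j))}"
      define x where "x = inv w (int y)"
      have x: "w x = int y"
        by (simp add: x_def)
      \<comment> \<open>If \<open>y\<close> stood at a negative position, oddness would place
        \<open>- y\<close> at a positive one, so \<open>y\<close> would be used.\<close>
      have "0 < x"
      proof (rule ccontr)
        assume "\<not> 0 < x"
        moreover have "x \<noteq> 0"
          using x y by (auto simp: C_def)
        ultimately have "F (nat (- x)) = Some y"
          using x y odd by (auto simp: F_iff C_def)
        then show False
          using y by (auto simp: C_def ran_def)
      qed
      moreover have "x < int j"
      proof (rule ccontr)
        assume "\<not> x < int j"
        moreover have "x \<noteq> int j"
          using x y by auto
        ultimately show False
          using chain_positive_increasing[OF chain, of "int j" x] x y j j' by (auto simp: C_def)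
      qed
      moreover have "F (nat x) = None"
        using x \<open>0 < x\<close> y by (simp add: F_def)
      ultimately have "nat x \<in> A" "y = nat (w (int (nat x)))"
        using x by (auto simp: A_def)
      then show "y \<in> (\<lambda>i. nat (w (int i))) ` A"
        by blast
    next
      fix y
      assume "y \<in> (\<lambda>i. nat (w (int i))) ` A"
      then obtain i where "i \<in> A" "y = nat (w (int i))"
        by blast
      then show "y \<in> {y \<in> C. y < nat (w (int j))}"
        using pos[of i] chain_positive_increasing[OF chain, of "int i" "int j"] j' by (auto simp: A_def)
    qed
    moreover have "inj_on (\<lambda>i. nat (w (int i))) A"
    proof (rule inj_onI)
      fix i k
      assume ik: "i \<in> A" "k \<in> A" and eq: "nat (w (int i)) = nat (w (int k))"
      have "0 < w (int i)" "0 < w (int k)"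
        using ik pos by (auto simp: A_def)
      then have "w (int i) = w (int k)"
        using eq by linarith
      then show "i = k"
        by simp
    qed
    ultimately have "card {y \<in> C. y < nat (w (int j))} = card A"
      using card_image by metis
    then show ?thesis
      using enumerate_card_below[OF infC j'(2)] j' None
      by (simp add: fill_positive_def flip: C_def A_def)
  qed
  have "w = triple_perm ks ps qs"
  proof
    fix i
    show "w i = triple_perm ks ps qs i"
      using fill[of "nat i"] fill[of "nat (- i)"] odd[of i]
      by (cases i "0 :: int" rule: linorder_cases) (auto simp: triple_perm_def F)
  qed
  then show ?thesis
    using triple unfolding signed_vexillary_def by blast
qed

theorem theorem2p5:
  fixes n :: nat and w :: "int \<Rightarrow> int"
  assumes "w \<in> W n"
  shows "(signed_vexillary w \<longleftrightarrow>
           (\<exists>xs. distinct xs \<and> set xs = essential_positions n w \<and>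
              sorted_wrt (\<lambda>(p, q) (p', q'). p \<ge> p' \<and> q \<ge> q') xs \<and>
              (\<forall>(p, q)\<in>set xs. p > 0 \<and> q > 0)))
       \<and> (signed_vexillary w \<longleftrightarrow> perm_vexillary {- int n..int n} (iota n w))"
  unfolding essential_chain_iff_corner_chain[OF assms] perm_vexillary_iff_corner_chain[OF assms]
  using signed_vexillary_imp_corner_chain[OF assms] corner_chain_imp_signed_vexillary[OF assms]
  by blast

end
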